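(* Let $N\ge 0$ be an integer and consider the wave equation $$-\partial_t^2\psi+\partial_x^2\psi+V(x)\,\psi=\sum_{n=0}^{N}a_n(t)\,\delta^{(n)}(x)$$ with $V=0$. Assume that $a_n(t)$ has at least $n$ derivatives. If $\psi$ is the exact solution of this equation, then $$\bar\psi=\psi-\sum_{i=0}^{\frac{N-1}{2}-1}\left[\delta^{(2i)}(x)\sum_{n=0}^{\frac{N-1}{2}-1-i}a_{2n+2i+2}^{(2n)}(t)+\delta^{(2i+1)}(x)\sum_{n=0}^{\frac{N-1}{2}-1-i}a_{2n+2i+3}^{(2n)}(t)\right]$$ solves $$-\partial_t^2\bar\psi+\partial_x^2\bar\psi=G(t)\,\delta(x)+F(t)\,\delta'(x),$$ where $$G(t)=\sum_{n=0}^{(N-1)/2}a_{2n}^{(2n)}(t),\qquad F(t)=\sum_{n=0}^{(N-1)/2}a_{2n+1}^{(2n)}(t).$$ If $N$ is even, these formulas are read with a zero coefficient $a_{N+1}=0$ appended to the source and $N$ replaced by the odd number $N+1$, which leaves the equation for $\psi$ unchanged.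
   Context: The equations are posed for $x\in[a,b]$ and are understood in the sense of distributions; $V$ is a potential. Here $\delta(x)$ is the Dirac delta distribution supported at $x=0$, $\delta^{(n)}(x)=\partial_x^n\delta(x)$ is its $n$-th distributional derivative in $x$ (so $\delta^{(0)}=\delta$ and $\delta^{(1)}=\delta'$), and $a_n^{(m)}(t)$ denotes the $m$-th derivative of $a_n$ with respect to $t$ (with $a_n^{(0)}=a_n$). The coefficients $a_n(t)$ are classical functions of $t$. Sums whose upper limit is smaller than the lower limit are empty (equal to $0$). *)

theory Defs
  imports "HOL-Analysis.Analysis"
begin

text \<open>
  Points of the plane are pairs \<open>(t, x)\<close> of time and space. A distribution is a functional on
  functions \<open>\<phi>\<close> on the plane of which only the values on test functions matter; two
  distributions on \<open>\<Omega>\<close> are equal if they agree on \<open>test_functions \<Omega>\<close>.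
\<close>

definition partial_t :: "(real \<times> real \<Rightarrow> real) \<Rightarrow> real \<times> real \<Rightarrow> real" where
  "partial_t \<phi> = (\<lambda>(t, x). deriv (\<lambda>s. \<phi> (s, x)) t)"

definition partial_x :: "(real \<times> real \<Rightarrow> real) \<Rightarrow> real \<times> real \<Rightarrow> real" where
  "partial_x \<phi> = (\<lambda>(t, x). deriv (\<lambda>y. \<phi> (t, y)) x)"

fun C_k :: "nat \<Rightarrow> (real \<times> real \<Rightarrow> real) \<Rightarrow> bool" where
  "C_k 0 \<phi> \<longleftrightarrow> continuous_on UNIV \<phi>"
| "C_k (Suc k) \<phi> \<longleftrightarrow> \<phi> differentiable_on UNIV \<and> C_k k (partial_t \<phi>) \<and> C_k k (partial_x \<phi>)"

definition supp :: "(real \<times> real \<Rightarrow> real) \<Rightarrow> (real \<times> real) set" where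
  "supp \<phi> = closure {p. \<phi> p \<noteq> 0}"

definition test_functions :: "(real \<times> real) set \<Rightarrow> (real \<times> real \<Rightarrow> real) set" where
  "test_functions \<Omega> = {\<phi>. (\<forall>k. C_k k \<phi>) \<and> compact (supp \<phi>) \<and> supp \<phi> \<subseteq> \<Omega>}"

text \<open>
  Continuity is expressed by the usual seminorm estimate on each compact subset of \<open>\<Omega>\<close>.
\<close>

definition distribution ::
    "(real \<times> real) set \<Rightarrow> ((real \<times> real \<Rightarrow> real) \<Rightarrow> real) \<Rightarrow> bool" where
  "distribution \<Omega> u \<longleftrightarrow>
     (\<forall>\<phi>\<in>test_functions \<Omega>. \<forall>\<eta>\<in>test_functions \<Omega>. u (\<lambda>p. \<phi> p + \<eta> p) = u \<phi> + u \<eta>) \<and>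
     (\<forall>\<phi>\<in>test_functions \<Omega>. \<forall>c. u (\<lambda>p. c * \<phi> p) = c * u \<phi>) \<and>
     (\<forall>K. compact K \<and> K \<subseteq> \<Omega> \<longrightarrow>
        (\<exists>C k. \<forall>\<phi>\<in>test_functions \<Omega>. supp \<phi> \<subseteq> K \<longrightarrow>
           \<bar>u \<phi>\<bar> \<le> C * (\<Sum>i\<le>k. \<Sum>j\<le>k - i. SUP p. \<bar>(partial_t ^^ i) ((partial_x ^^ j) \<phi>) p\<bar>)))"

definition dist_t ::
    "((real \<times> real \<Rightarrow> real) \<Rightarrow> real) \<Rightarrow> (real \<times> real \<Rightarrow> real) \<Rightarrow> real" where
  "dist_t u = (\<lambda>\<phi>. - u (partial_t \<phi>))"

definition dist_x ::
    "((real \<times> real \<Rightarrow> real) \<Rightarrow> real) \<Rightarrow> (real \<times> real \<Rightarrow> real) \<Rightarrow> real" where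
  "dist_x u = (\<lambda>\<phi>. - u (partial_x \<phi>))"

definition wave ::
    "((real \<times> real \<Rightarrow> real) \<Rightarrow> real) \<Rightarrow> (real \<times> real \<Rightarrow> real) \<Rightarrow> real" where
  "wave u = (\<lambda>\<phi>. - dist_t (dist_t u) \<phi> + dist_x (dist_x u) \<phi>)"

definition dirac :: "(real \<Rightarrow> real) \<Rightarrow> real" where
  "dirac f = f 0"

definition dist_deriv :: "((real \<Rightarrow> real) \<Rightarrow> real) \<Rightarrow> (real \<Rightarrow> real) \<Rightarrow> real" where
  "dist_deriv v = (\<lambda>f. - v (deriv f))"

definition delta :: "nat \<Rightarrow> (real \<Rightarrow> real) \<Rightarrow> real" where
  "delta n = (dist_deriv ^^ n) dirac"

text \<open>
  The product \<open>c(t) v(x)\<close> of a function \<open>c\<close> on the time interval \<open>T\<close> and a distribution \<open>v\<close>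
  in \<open>x\<close>, i.e. their tensor product. The Henstock-Kurzweil integral is the Lebesgue integral
  when \<open>c\<close> is locally Lebesgue integrable; it also covers the case where \<open>c\<close> is an everywhere
  existing derivative that is not locally Lebesgue integrable.
\<close>

definition time_times ::
    "real set \<Rightarrow> (real \<Rightarrow> real) \<Rightarrow> ((real \<Rightarrow> real) \<Rightarrow> real) \<Rightarrow> (real \<times> real \<Rightarrow> real) \<Rightarrow> real" where
  "time_times T c v = (\<lambda>\<phi>. integral T (\<lambda>t. c t * v (\<lambda>x. \<phi> (t, x))))"

definition locally_integrable_on :: "(real \<Rightarrow> real) \<Rightarrow> real set \<Rightarrow> bool" where
  "locally_integrable_on f T \<longleftrightarrow> (\<forall>c d. {c..d} \<subseteq> T \<longrightarrow> f absolutely_integrable_on {c..d})"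

definition times_differentiable_on :: "nat \<Rightarrow> (real \<Rightarrow> real) \<Rightarrow> real set \<Rightarrow> bool" where
  "times_differentiable_on n f T \<longleftrightarrow> (\<forall>k<n. (deriv ^^ k) f differentiable_on T)"

text \<open>
  For even \<open>N\<close> the coefficient list is extended by a zero coefficient and \<open>N\<close> is replaced by
  \<open>N + 1\<close>; the formulas below are applied to \<open>padded N a\<close> and \<open>odd_order N\<close>. The upper
  summation limits \<open>(N - 1) / 2 - 1\<close> and \<open>(N - 1) / 2 - 1 - i\<close> become strict bounds, so that
  the sums are empty for \<open>N = 1\<close>.
\<close>

definition odd_order :: "nat \<Rightarrow> nat" where
  "odd_order N = (if odd N then N else N + 1)"

definition padded :: "nat \<Rightarrow> (nat \<Rightarrow> real \<Rightarrow> real) \<Rightarrow> nat \<Rightarrow> real \<Rightarrow> real" where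
  "padded N a n = (if n \<le> N then a n else (\<lambda>t. 0))"

definition psi_bar ::
    "real set \<Rightarrow> nat \<Rightarrow> (nat \<Rightarrow> real \<Rightarrow> real) \<Rightarrow> ((real \<times> real \<Rightarrow> real) \<Rightarrow> real)
      \<Rightarrow> (real \<times> real \<Rightarrow> real) \<Rightarrow> real" where
  "psi_bar T N a \<psi> = (\<lambda>\<phi>. \<psi> \<phi> -
     (\<Sum>i<(N - 1) div 2.
        time_times T (\<lambda>t. \<Sum>n<(N - 1) div 2 - i. (deriv ^^ (2*n)) (a (2*n + 2*i + 2)) t)
          (delta (2*i)) \<phi> +
        time_times T (\<lambda>t. \<Sum>n<(N - 1) div 2 - i. (deriv ^^ (2*n)) (a (2*n + 2*i + 3)) t)
          (delta (2*i + 1)) \<phi>))"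

definition G_coeff :: "nat \<Rightarrow> (nat \<Rightarrow> real \<Rightarrow> real) \<Rightarrow> real \<Rightarrow> real" where
  "G_coeff N a t = (\<Sum>n\<le>(N - 1) div 2. (deriv ^^ (2*n)) (a (2*n)) t)"

definition F_coeff :: "nat \<Rightarrow> (nat \<Rightarrow> real \<Rightarrow> real) \<Rightarrow> real \<Rightarrow> real" where
  "F_coeff N a t = (\<Sum>n\<le>(N - 1) div 2. (deriv ^^ (2*n)) (a (2*n + 1)) t)"

end

theory Submission
  imports Defs
begin

text \<open>
  Integration by parts in time gives
  \<open>wave (c(t) \<delta>^(m)) = c(t) \<delta>^(m+2) - c''(t) \<delta>^(m)\<close>. Applied to
  \<open>c = a_j^(2n)\<close>, it replaces the source term \<open>a_j^(2n) \<delta>^(m+2)\<close> by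
  \<open>a_j^(2n+2) \<delta>^(m)\<close>. Repeating this lowers every \<open>a_n \<delta>^(n)\<close> to a multiple
  of \<open>\<delta>\<close> or \<open>\<delta>'\<close>, and the double sum in \<open>psi_bar\<close> telescopes. The highest
  derivative of \<open>a_n\<close> involved exists pointwise but need not be Lebesgue integrable; its product
  with a test function is nevertheless Henstock-Kurzweil integrable, by the fundamental theorem of
  calculus for everywhere differentiable functions.
\<close>

subsection \<open>Smooth functions and test functions\<close>

definition smooth :: "(real \<times> real \<Rightarrow> real) \<Rightarrow> bool" where
  "smooth \<phi> \<longleftrightarrow> (\<forall>k. C_k k \<phi>)"

lemma smooth_differentiable: "smooth \<phi> \<Longrightarrow> \<phi> differentiable (at p)"
  unfolding smooth_def
  by (metis C_k.simps(2) UNIV_I differentiable_on_def)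

lemma smooth_continuous: "smooth \<phi> \<Longrightarrow> continuous_on S \<phi>"
  unfolding smooth_def by (metis C_k.simps(1) continuous_on_subset subset_UNIV)

lemma smooth_partial_t: "smooth \<phi> \<Longrightarrow> smooth (partial_t \<phi>)"
  and smooth_partial_x: "smooth \<phi> \<Longrightarrow> smooth (partial_x \<phi>)"
  unfolding smooth_def by (metis C_k.simps(2))+

section \<open>Derivatives along coordinate slices and symmetry of mixed partials\<close>

lemma slice_t_has_derivative:
  assumes "smooth \<phi>"
  shows "((\<lambda>s. \<phi> (s, x)) has_real_derivative partial_t \<phi> (t, x)) (at t within S)"
proof -
  have "(\<lambda>s. (s, x)) differentiable (at t)"
    unfolding differentiable_def by (rule exI) (rule has_derivative_Pair has_derivative_ident has_derivative_const)+
  then have "(\<phi> \<circ> (\<lambda>s. (s, x))) differentiable (at t)"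
    by (rule differentiable_chain_at) (rule smooth_differentiable[OF assms])
  then have "((\<lambda>s. \<phi> (s, x)) has_real_derivative partial_t \<phi> (t, x)) (at t)"
    by (simp add: partial_t_def o_def DERIV_deriv_iff_real_differentiable)
  then show ?thesis by (rule has_field_derivative_at_within)
qed

lemma slice_x_has_derivative:
  assumes "smooth \<phi>"
  shows "((\<lambda>y. \<phi> (t, y)) has_real_derivative partial_x \<phi> (t, x)) (at x within S)"
proof -
  have "(\<lambda>y. (t, y)) differentiable (at x)"
    unfolding differentiable_def by (rule exI) (rule has_derivative_Pair has_derivative_ident has_derivative_const)+
  then have "(\<phi> \<circ> (\<lambda>y. (t, y))) differentiable (at x)"
    by (rule differentiable_chain_at) (rule smooth_differentiable[OF assms])
  then have "((\<lambda>y. \<phi> (t, y)) has_real_derivative partial_x \<phi> (t, x)) (at x)"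
    by (simp add: partial_x_def o_def DERIV_deriv_iff_real_differentiable)
  then show ?thesis by (rule has_field_derivative_at_within)
qed

text \<open>Write \<open>\<phi>\<close> as the space integral of \<open>partial_x \<phi>\<close>
  from a base point, differentiate under the integral sign in time, then differentiate in the upper
  limit. The result lets time derivatives move past the space derivatives that
  \<open>delta m\<close> puts on a test function.\<close>

lemma partials_commute:
  assumes "smooth \<phi>"
  shows "partial_x (partial_t \<phi>) = partial_t (partial_x \<phi>)"
proof (rule ext, clarify)
  fix t x :: real
  \<comment> \<open>The base point \<open>l\<close> lies to the left of \<open>x\<close>, and
    \<open>u\<close> to the right, so that \<open>x\<close> is interior to
    \<open>{l..u}\<close>.\<close>
  define l u where "l = x - 1" and "u = x + 1"
  have smooth_x: "smooth (partial_x \<phi>)" and smooth_xt: "smooth (partial_t (partial_x \<phi>))"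
    using assms smooth_partial_t smooth_partial_x by blast+
  have cont: "continuous_on S (\<lambda>z. \<eta> (s, z))" if "smooth \<eta>" for S \<eta> s
    using that by (intro continuous_on_compose2[OF smooth_continuous[of \<eta> UNIV]] continuous_intros) auto
  have ftc: "\<phi> (s, y) = \<phi> (s, l) + integral {l..y} (\<lambda>z. partial_x \<phi> (s, z))" if "l \<le> y" for s y
  proof -
    have "((\<lambda>z. partial_x \<phi> (s, z)) has_integral \<phi> (s, y) - \<phi> (s, l)) {l..y}"
      using that slice_x_has_derivative[OF assms]
      by (intro fundamental_theorem_of_calculus)
        (auto simp flip: has_real_derivative_iff_has_vector_derivative)
    then show ?thesis by (simp add: integral_unique)
  qed
  have partial_t_eq: "partial_t \<phi> (t, y) =
      partial_t \<phi> (t, l) + integral {l..y} (\<lambda>z. partial_t (partial_x \<phi>) (t, z))"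
    if "l \<le> y" for y
  proof (rule DERIV_unique)
    show "((\<lambda>s. \<phi> (s, y)) has_real_derivative partial_t \<phi> (t, y)) (at t)"
      by (rule slice_t_has_derivative[OF assms])
    have "((\<lambda>s. integral (cbox l y) (\<lambda>z. partial_x \<phi> (s, z))) has_real_derivative
        integral (cbox l y) (\<lambda>z. partial_t (partial_x \<phi>) (t, z))) (at t within UNIV)"
      using slice_t_has_derivative[OF smooth_x] cont[OF smooth_x] smooth_continuous[OF smooth_xt]
      by (intro leibniz_rule_field_derivative) (auto intro!: integrable_continuous_real)
    then have "((\<lambda>s. \<phi> (s, l) + integral {l..y} (\<lambda>z. partial_x \<phi> (s, z))) has_real_derivative
        partial_t \<phi> (t, l) + integral {l..y} (\<lambda>z. partial_t (partial_x \<phi>) (t, z))) (at t)"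
      by (intro DERIV_add slice_t_has_derivative[OF assms]) simp
    then show "((\<lambda>s. \<phi> (s, y)) has_real_derivative
        partial_t \<phi> (t, l) + integral {l..y} (\<lambda>z. partial_t (partial_x \<phi>) (t, z))) (at t)"
      by (simp flip: ftc[OF that])
  qed
  \<comment> \<open>The representation \<open>partial_t_eq\<close> holds for
    \<open>l \<le> y\<close>, so the derivative is first taken within \<open>{l..u}\<close>; it is
    two-sided because \<open>x\<close> is interior.\<close>
  have "((\<lambda>y. partial_t \<phi> (t, l) + integral {l..y} (\<lambda>z. partial_t (partial_x \<phi>) (t, z)))
      has_real_derivative 0 + partial_t (partial_x \<phi>) (t, x)) (at x within {l..u})"
    by (rule DERIV_add[OF DERIV_const integral_has_real_derivative[OF cont[OF smooth_xt]]])
      (simp add: l_def u_def)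
  then have "((\<lambda>y. partial_t \<phi> (t, y)) has_real_derivative partial_t (partial_x \<phi>) (t, x))
      (at x within {l..u})"
    unfolding add_0 by (rule has_field_derivative_transform_within[OF _ zero_less_one])
      (simp_all add: partial_t_eq[symmetric], simp_all add: l_def u_def)
  moreover have "at x within {l..u} = at x"
    by (rule at_within_interior) (auto simp: l_def u_def)
  ultimately have "((\<lambda>y. partial_t \<phi> (t, y)) has_real_derivative partial_t (partial_x \<phi>) (t, x)) (at x)"
    by simp
  then show "partial_x (partial_t \<phi>) (t, x) = partial_t (partial_x \<phi>) (t, x)"
    using slice_x_has_derivative[OF smooth_partial_t[OF assms]] DERIV_unique by blast
qed

lemma smooth_partial_x_pow: "smooth \<phi> \<Longrightarrow> smooth ((partial_x ^^ m) \<phi>)"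
  by (induction m) (auto intro: smooth_partial_x)

lemma partial_x_pow_partial_t:
  "smooth \<phi> \<Longrightarrow> (partial_x ^^ m) (partial_t \<phi>) = partial_t ((partial_x ^^ m) \<phi>)"
  by (induction m) (auto simp: partials_commute smooth_partial_x_pow)

text \<open>Translates the slice derivatives that \<open>delta\<close> evaluates into partial
  derivatives, under which test functions are closed.\<close>

lemma partial_x_pow_eq: "(partial_x ^^ m) \<phi> (t, x) = (deriv ^^ m) (\<lambda>y. \<phi> (t, y)) x"
  by (induction m arbitrary: x) (auto simp: partial_x_def)

section \<open>Supports and closure properties of test functions\<close>

lemma test_functions_iff:
  "\<phi> \<in> test_functions \<Omega> \<longleftrightarrow> smooth \<phi> \<and> compact (supp \<phi>) \<and> supp \<phi> \<subseteq> \<Omega>"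
  by (simp add: test_functions_def smooth_def)

lemma notin_supp: "p \<notin> supp \<phi> \<Longrightarrow> \<phi> p = 0"
  using closure_subset[of "{p. \<phi> p \<noteq> 0}"] unfolding supp_def by auto

lemma supp_subsetI: "closed K \<Longrightarrow> (\<And>p. p \<notin> K \<Longrightarrow> \<phi> p = 0) \<Longrightarrow> supp \<phi> \<subseteq> K"
  unfolding supp_def by (rule closure_minimal) auto

lemma closed_supp: "closed (supp \<phi>)"
  by (simp add: supp_def)

text \<open>The complement of the closed support is open, so at a point off it \<open>\<phi>\<close>
  vanishes for all nearby times and has the derivative of the zero function.\<close>

lemma supp_partial_t: "supp (partial_t \<phi>) \<subseteq> supp \<phi>"
proof (rule supp_subsetI[OF closed_supp], clarify)
  fix t x assume "(t, x) \<notin> supp \<phi>"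
  then have "\<forall>\<^sub>F s in nhds t. (s, x) \<in> - supp \<phi>"
    by (intro eventually_compose_filterlim[OF eventually_nhds_in_open, of "- supp \<phi>" "(t, x)"])
      (auto intro!: tendsto_intros filterlim_ident simp: closed_supp)
  then have "\<forall>\<^sub>F s in nhds t. \<phi> (s, x) = 0"
    by eventually_elim (simp add: notin_supp)
  then have "deriv (\<lambda>s. \<phi> (s, x)) t = deriv (\<lambda>s. 0) t"
    by (rule deriv_cong_ev) simp
  then show "partial_t \<phi> (t, x) = 0" by (simp add: partial_t_def)
qed

lemma supp_partial_x: "supp (partial_x \<phi>) \<subseteq> supp \<phi>"
proof (rule supp_subsetI[OF closed_supp], clarify)
  fix t x assume "(t, x) \<notin> supp \<phi>"
  then have "\<forall>\<^sub>F y in nhds x. (t, y) \<in> - supp \<phi>"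
    by (intro eventually_compose_filterlim[OF eventually_nhds_in_open, of "- supp \<phi>" "(t, x)"])
      (auto intro!: tendsto_intros filterlim_ident simp: closed_supp)
  then have "\<forall>\<^sub>F y in nhds x. \<phi> (t, y) = 0"
    by eventually_elim (simp add: notin_supp)
  then have "deriv (\<lambda>y. \<phi> (t, y)) x = deriv (\<lambda>y. 0) x"
    by (rule deriv_cong_ev) simp
  then show "partial_x \<phi> (t, x) = 0" by (simp add: partial_x_def)
qed

lemma test_functions_closed_subset:
  "\<lbrakk>\<phi> \<in> test_functions \<Omega>; smooth \<eta>; supp \<eta> \<subseteq> supp \<phi>\<rbrakk> \<Longrightarrow> \<eta> \<in> test_functions \<Omega>"
  unfolding test_functions_iff
  using compact_Int_closed[OF _ closed_supp, of "supp \<phi>" \<eta>] by (auto simp: inf.absorb2)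

lemma test_functions_partial_t: "\<phi> \<in> test_functions \<Omega> \<Longrightarrow> partial_t \<phi> \<in> test_functions \<Omega>"
  using test_functions_closed_subset smooth_partial_t supp_partial_t test_functions_iff by blast

lemma test_functions_partial_x: "\<phi> \<in> test_functions \<Omega> \<Longrightarrow> partial_x \<phi> \<in> test_functions \<Omega>"
  using test_functions_closed_subset smooth_partial_x supp_partial_x test_functions_iff by blast

lemma test_functions_partials:
  "\<phi> \<in> test_functions \<Omega> \<Longrightarrow> (partial_t ^^ i) ((partial_x ^^ j) \<phi>) \<in> test_functions \<Omega>"
proof -
  have "\<phi> \<in> test_functions \<Omega> \<Longrightarrow> (partial_x ^^ j) \<phi> \<in> test_functions \<Omega>" for \<phi>
    by (induction j) (auto intro: test_functions_partial_x)
  moreover have "\<phi> \<in> test_functions \<Omega> \<Longrightarrow> (partial_t ^^ i) \<phi> \<in> test_functions \<Omega>" for \<phi>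
    by (induction i) (auto intro: test_functions_partial_t)
  ultimately show "\<phi> \<in> test_functions \<Omega> \<Longrightarrow> ?thesis" by blast
qed

lemma supp_partial_x_pow: "supp ((partial_x ^^ j) \<phi>) \<subseteq> supp \<phi>"
  by (induction j) (use supp_partial_x in fastforce)+

text \<open>Gives the suprema in the seminorms their meaning: a continuous function is bounded on
  its compact support and zero elsewhere.\<close>

lemma bdd_above_abs_test_function:
  assumes "\<phi> \<in> test_functions \<Omega>"
  shows "bdd_above (range (\<lambda>p. \<bar>\<phi> p\<bar>))"
proof -
  have "compact ((\<lambda>p. \<bar>\<phi> p\<bar>) ` supp \<phi>)"
    using assms
    by (intro compact_continuous_image continuous_intros smooth_continuous) (auto simp: test_functions_iff)
  then have "bdd_above ((\<lambda>p. \<bar>\<phi> p\<bar>) ` supp \<phi>)"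
    by (intro bounded_imp_bdd_above compact_imp_bounded)
  then obtain B where "\<And>p. p \<in> supp \<phi> \<Longrightarrow> \<bar>\<phi> p\<bar> \<le> B"
    by (auto simp: bdd_above_def)
  then have "\<bar>\<phi> p\<bar> \<le> max B 0" for p
    \<comment> \<open>Off the support the value is 0, which \<open>B\<close> need not dominate: for
      an empty support \<open>B\<close> may be negative.\<close>
    by (cases "p \<in> supp \<phi>") (simp_all add: notin_supp max.coboundedI1)
  then show ?thesis by (auto simp: bdd_above_def)
qed

lemma partial_x_pow_add:
  assumes "smooth \<phi>" "smooth \<eta>"
  shows "(partial_x ^^ m) (\<lambda>p. \<phi> p + \<eta> p) = (\<lambda>p. (partial_x ^^ m) \<phi> p + (partial_x ^^ m) \<eta> p)"
proof (induction m)
  case (Suc m)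
  have "partial_x (\<lambda>p. (partial_x ^^ m) \<phi> p + (partial_x ^^ m) \<eta> p) (t, x) =
      partial_x ((partial_x ^^ m) \<phi>) (t, x) + partial_x ((partial_x ^^ m) \<eta>) (t, x)" for t x
    unfolding partial_x_def[of "\<lambda>p. _ p + _ p"] prod.case
    by (intro DERIV_imp_deriv DERIV_add slice_x_has_derivative smooth_partial_x_pow assms)
  with Suc show ?case by auto
qed simp

lemma partial_x_pow_cmult:
  assumes "smooth \<phi>"
  shows "(partial_x ^^ m) (\<lambda>p. c * \<phi> p) = (\<lambda>p. c * (partial_x ^^ m) \<phi> p)"
proof (induction m)
  case (Suc m)
  have "partial_x (\<lambda>p. c * (partial_x ^^ m) \<phi> p) (t, x) =
      c * partial_x ((partial_x ^^ m) \<phi>) (t, x)" for t x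
    unfolding partial_x_def[of "\<lambda>p. c * _ p"] prod.case
    by (intro DERIV_imp_deriv DERIV_cmult slice_x_has_derivative smooth_partial_x_pow assms)
  with Suc show ?case by auto
qed simp

subsection \<open>Seminorms and distributions\<close>

definition seminorm :: "nat \<Rightarrow> (real \<times> real \<Rightarrow> real) \<Rightarrow> real" where
  "seminorm k \<phi> = (\<Sum>i\<le>k. \<Sum>j\<le>k - i. SUP p. \<bar>(partial_t ^^ i) ((partial_x ^^ j) \<phi>) p\<bar>)"

lemma abs_partials_le_SUP:
  assumes "\<phi> \<in> test_functions \<Omega>"
  shows "\<bar>(partial_t ^^ i) ((partial_x ^^ j) \<phi>) p\<bar> \<le> (SUP p. \<bar>(partial_t ^^ i) ((partial_x ^^ j) \<phi>) p\<bar>)"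
  by (rule cSUP_upper[OF UNIV_I bdd_above_abs_test_function[OF test_functions_partials[OF assms]]])

lemma SUP_partials_nonneg:
  assumes "\<phi> \<in> test_functions \<Omega>"
  shows "0 \<le> (SUP p. \<bar>(partial_t ^^ i) ((partial_x ^^ j) \<phi>) p\<bar>)"
  using abs_partials_le_SUP[OF assms, of i j] by (meson abs_ge_zero order_trans)

lemma seminorm_nonneg: "\<phi> \<in> test_functions \<Omega> \<Longrightarrow> 0 \<le> seminorm k \<phi>"
  unfolding seminorm_def by (intro sum_nonneg SUP_partials_nonneg)

text \<open>A larger order enlarges the triangle \<open>i + j \<le> k\<close> of nonnegative terms,
  first in \<open>j\<close> for each fixed \<open>i\<close>, then in \<open>i\<close>.\<close>

lemma seminorm_mono:
  assumes "\<phi> \<in> test_functions \<Omega>" "k \<le> k'"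
  shows "seminorm k \<phi> \<le> seminorm k' \<phi>"
proof -
  have "seminorm k \<phi> \<le> (\<Sum>i\<le>k. \<Sum>j\<le>k' - i. SUP p. \<bar>(partial_t ^^ i) ((partial_x ^^ j) \<phi>) p\<bar>)"
    unfolding seminorm_def
    using assms by (intro sum_mono sum_mono2 SUP_partials_nonneg) auto
  also have "\<dots> \<le> seminorm k' \<phi>"
    unfolding seminorm_def
    using assms by (intro sum_mono2 sum_nonneg SUP_partials_nonneg) auto
  finally show ?thesis .
qed

text \<open>The term \<open>i = 0\<close>, \<open>j = m\<close> of the seminorm already dominates
  the left side, and the other terms are nonnegative.\<close>

lemma abs_partial_x_pow_le_seminorm:
  assumes "\<phi> \<in> test_functions \<Omega>"
  shows "\<bar>(partial_x ^^ m) \<phi> p\<bar> \<le> seminorm m \<phi>"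
proof -
  let ?S = "\<lambda>i j. SUP p. \<bar>(partial_t ^^ i) ((partial_x ^^ j) \<phi>) p\<bar>"
  have "\<bar>(partial_x ^^ m) \<phi> p\<bar> \<le> ?S 0 m"
    using abs_partials_le_SUP[OF assms, of 0 m p] by simp
  also have "\<dots> \<le> (\<Sum>j\<le>m - 0. ?S 0 j)"
    by (rule member_le_sum[where f = "?S 0"]) (simp, rule SUP_partials_nonneg[OF assms], simp)
  also have "\<dots> \<le> seminorm m \<phi>"
    unfolding seminorm_def
    by (rule member_le_sum[where f = "\<lambda>i. \<Sum>j\<le>m - i. ?S i j"])
      (simp, intro sum_nonneg SUP_partials_nonneg[OF assms], simp)
  finally show ?thesis .
qed

lemma distribution_iff:
  "distribution \<Omega> u \<longleftrightarrow>
     (\<forall>\<phi>\<in>test_functions \<Omega>. \<forall>\<eta>\<in>test_functions \<Omega>. u (\<lambda>p. \<phi> p + \<eta> p) = u \<phi> + u \<eta>) \<and>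
     (\<forall>\<phi>\<in>test_functions \<Omega>. \<forall>c. u (\<lambda>p. c * \<phi> p) = c * u \<phi>) \<and>
     (\<forall>K. compact K \<and> K \<subseteq> \<Omega> \<longrightarrow>
        (\<exists>C k. \<forall>\<phi>\<in>test_functions \<Omega>. supp \<phi> \<subseteq> K \<longrightarrow> \<bar>u \<phi>\<bar> \<le> C * seminorm k \<phi>))"
  unfolding distribution_def seminorm_def ..

text \<open>The scalar \<open>c\<close> lets one estimate serve both sums (\<open>c = 1\<close>) and
  differences (\<open>c = -1\<close>).\<close>

lemma distribution_lincomb:
  assumes u: "distribution \<Omega> u" and v: "distribution \<Omega> v"
  shows "distribution \<Omega> (\<lambda>\<phi>. u \<phi> + c * v \<phi>)"
  unfolding distribution_iff
proof (intro conjI allI impI ballI)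
  fix \<phi> \<eta> assume "\<phi> \<in> test_functions \<Omega>" "\<eta> \<in> test_functions \<Omega>"
  then show "u (\<lambda>p. \<phi> p + \<eta> p) + c * v (\<lambda>p. \<phi> p + \<eta> p) = u \<phi> + c * v \<phi> + (u \<eta> + c * v \<eta>)"
    using u v by (simp add: distribution_iff algebra_simps)
next
  fix \<phi> d assume "\<phi> \<in> test_functions \<Omega>"
  then show "u (\<lambda>p. d * \<phi> p) + c * v (\<lambda>p. d * \<phi> p) = d * (u \<phi> + c * v \<phi>)"
    using u v by (simp add: distribution_iff algebra_simps)
next
  fix K assume K: "compact K \<and> K \<subseteq> \<Omega>"
  obtain C k where C: "\<And>\<phi>. \<lbrakk>\<phi> \<in> test_functions \<Omega>; supp \<phi> \<subseteq> K\<rbrakk> \<Longrightarrow> \<bar>u \<phi>\<bar> \<le> C * seminorm k \<phi>"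
    using u K unfolding distribution_iff by meson
  obtain D l where D: "\<And>\<phi>. \<lbrakk>\<phi> \<in> test_functions \<Omega>; supp \<phi> \<subseteq> K\<rbrakk> \<Longrightarrow> \<bar>v \<phi>\<bar> \<le> D * seminorm l \<phi>"
    using v K unfolding distribution_iff by meson
  \<comment> \<open>The larger order dominates both seminorms. Absolute values of \<open>C\<close>
    and \<open>D\<close> are taken because the constants in the definition may be negative.\<close>
  have "\<bar>u \<phi> + c * v \<phi>\<bar> \<le> (\<bar>C\<bar> + \<bar>c\<bar> * \<bar>D\<bar>) * seminorm (max k l) \<phi>"
    if \<phi>: "\<phi> \<in> test_functions \<Omega>" "supp \<phi> \<subseteq> K" for \<phi>
  proof -
    have bound: "B * seminorm j \<phi> \<le> \<bar>B\<bar> * seminorm (max k l) \<phi>" if "j \<le> max k l" for B j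
      using seminorm_mono[OF \<phi>(1) that] seminorm_nonneg[OF \<phi>(1), of j]
      by (intro mult_mono) auto
    have "\<bar>u \<phi> + c * v \<phi>\<bar> \<le> \<bar>u \<phi>\<bar> + \<bar>c\<bar> * \<bar>v \<phi>\<bar>"
      by (metis abs_mult abs_triangle_ineq)
    also have "\<dots> \<le> \<bar>C\<bar> * seminorm (max k l) \<phi> + \<bar>c\<bar> * (\<bar>D\<bar> * seminorm (max k l) \<phi>)"
      using C[OF \<phi>] D[OF \<phi>] bound[of k C] bound[of l D]
      by (intro add_mono mult_left_mono) auto
    finally show ?thesis by (simp add: algebra_simps)
  qed
  then show "\<exists>C k. \<forall>\<phi>\<in>test_functions \<Omega>. supp \<phi> \<subseteq> K \<longrightarrow> \<bar>u \<phi> + c * v \<phi>\<bar> \<le> C * seminorm k \<phi>"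
    by blast
qed

lemma distribution_zero: "distribution \<Omega> (\<lambda>\<phi>. 0)"
  unfolding distribution_iff by (auto intro!: exI[of _ 0])

lemma distribution_add: "\<lbrakk>distribution \<Omega> u; distribution \<Omega> v\<rbrakk> \<Longrightarrow> distribution \<Omega> (\<lambda>\<phi>. u \<phi> + v \<phi>)"
  using distribution_lincomb[of \<Omega> u v 1] by simp

lemma distribution_diff: "\<lbrakk>distribution \<Omega> u; distribution \<Omega> v\<rbrakk> \<Longrightarrow> distribution \<Omega> (\<lambda>\<phi>. u \<phi> - v \<phi>)"
  using distribution_lincomb[of \<Omega> u v "-1"] by simp

lemma distribution_sum:
  "(\<And>i. i \<in> I \<Longrightarrow> distribution \<Omega> (u i)) \<Longrightarrow> distribution \<Omega> (\<lambda>\<phi>. \<Sum>i\<in>I. u i \<phi>)"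
proof (induction I rule: infinite_finite_induct)
  case (insert i I)
  then show ?case using distribution_add[of \<Omega> "u i" "\<lambda>\<phi>. \<Sum>i\<in>I. u i \<phi>"] by simp
qed (simp_all add: distribution_zero)

subsection \<open>Products of time coefficients with derivatives of the Dirac delta\<close>

lemma delta_eq: "delta m f = (- 1) ^ m * (deriv ^^ m) f 0"
proof -
  have "(dist_deriv ^^ m) v f = (- 1) ^ m * v ((deriv ^^ m) f)" for v
    by (induction m arbitrary: f) (simp_all add: dist_deriv_def funpow_swap1[of deriv])
  then show ?thesis by (simp add: delta_def dirac_def)
qed

text \<open>Reduces the pairing to a time integral along the line \<open>x = 0\<close>, the form in
  which the later identities are checked.\<close>

lemma time_times_delta:
  "time_times T c (delta m) \<phi> = (- 1) ^ m * integral T (\<lambda>t. c t * (partial_x ^^ m) \<phi> (t, 0))"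
  unfolding time_times_def delta_eq partial_x_pow_eq
  by (simp add: mult.left_commute flip: integral_mult_right)

text \<open>The space half of the wave operator: two derivatives raise the order by two, and their
  signs cancel.\<close>

lemma time_times_delta_partial_x:
  "time_times T c (delta m) (partial_x (partial_x \<phi>)) = time_times T c (delta (m + 2)) \<phi>"
  by (simp add: time_times_delta funpow_swap1)

text \<open>The earliest and latest times of \<open>K\<close> are attained inside the open set
  \<open>T\<close>, which leaves room beyond each; the interval property fills in between. The
  strict bounds later make boundary terms vanish.\<close>

lemma compact_subset_time_interval:
  fixes T X :: "real set"
  assumes "open T" "is_interval T" "compact K" "K \<subseteq> T \<times> X"
  obtains l u where "{l..u} \<subseteq> T" "\<And>t x. (t, x) \<in> K \<Longrightarrow> l < t \<and> t < u"
proof (cases "K = {}")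
  case True
  \<comment> \<open>The interval \<open>{1..0}\<close> is empty.\<close>
  then show thesis using that[of 1 0] by auto
next
  case False
  have cpt: "compact (fst ` K)" "fst ` K \<noteq> {}" "fst ` K \<subseteq> T"
    using False assms by (auto intro!: compact_continuous_image continuous_intros)
  obtain s where s: "s \<in> fst ` K" "\<And>t. t \<in> fst ` K \<Longrightarrow> s \<le> t"
    using compact_attains_inf[OF cpt(1,2)] by blast
  obtain r where r: "r \<in> fst ` K" "\<And>t. t \<in> fst ` K \<Longrightarrow> t \<le> r"
    using compact_attains_sup[OF cpt(1,2)] by blast
  obtain d where d: "0 < d" "cball s d \<subseteq> T"
    using assms(1) s(1) cpt(3) open_contains_cball by blast
  obtain e where e: "0 < e" "cball r e \<subseteq> T"
    using assms(1) r(1) cpt(3) open_contains_cball by blast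
  have ends: "s - d \<in> T" "r + e \<in> T"
    using d e by (auto simp: subset_iff dist_real_def)
  show thesis
  proof (rule that)
    show "{s - d..r + e} \<subseteq> T"
      using ends assms(2) unfolding is_interval_1 by (meson atLeastAtMost_iff subsetI)
    fix t x assume "(t, x) \<in> K"
    then have "t \<in> fst ` K" by force
    then have "s \<le> t" "t \<le> r" using s(2) r(2) by blast+
    then show "s - d < t \<and> t < r + e" using d(1) e(1) by simp
  qed
qed

text \<open>The Henstock-Kurzweil integrability that the pairing of \<open>c(t) \<delta>(x)\<close>
  with a test function requires. It is weak enough for everywhere existing derivatives that are not
  locally Lebesgue integrable.\<close>

definition pairs_with_tests :: "real set \<Rightarrow> real set \<Rightarrow> (real \<Rightarrow> real) \<Rightarrow> bool" where
  "pairs_with_tests T X c \<longleftrightarrow>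
     (\<forall>\<phi>\<in>test_functions (T \<times> X). (\<lambda>t. c t * \<phi> (t, 0)) integrable_on T)"

lemma pairs_with_testsD:
  assumes "pairs_with_tests T X c" "\<phi> \<in> test_functions (T \<times> X)"
  shows "(\<lambda>t. c t * (partial_x ^^ m) \<phi> (t, 0)) integrable_on T"
  using assms test_functions_partials[of \<phi> _ 0 m] by (simp add: pairs_with_tests_def)

lemma slice_continuous: "smooth \<phi> \<Longrightarrow> continuous_on S (\<lambda>t. \<phi> (t, x))"
  by (intro continuous_on_compose2[OF smooth_continuous[of \<phi> UNIV]] continuous_intros) auto

text \<open>The slice of a test function is bounded, measurable and zero outside a compact
  subinterval of \<open>T\<close>, so its product with \<open>c\<close> is integrable there and
  extends by zero.\<close>

lemma pairs_with_tests_locally_integrable: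
  assumes "open T" "is_interval T" "locally_integrable_on c T"
  shows "pairs_with_tests T X c"
  unfolding pairs_with_tests_def
proof
  fix \<phi> assume \<phi>: "\<phi> \<in> test_functions (T \<times> X)"
  obtain l u where lu: "{l..u} \<subseteq> T" "\<And>t x. (t, x) \<in> supp \<phi> \<Longrightarrow> l < t \<and> t < u"
    using compact_subset_time_interval[OF assms(1,2)] \<phi> unfolding test_functions_iff by metis
  have cont: "continuous_on {l..u} (\<lambda>t. \<phi> (t, 0))"
    using \<phi> by (intro slice_continuous) (simp add: test_functions_iff)
  have "(\<lambda>t. \<phi> (t, 0) * c t) absolutely_integrable_on {l..u}"
  proof (rule absolutely_integrable_bounded_measurable_product_real)
    show "(\<lambda>t. \<phi> (t, 0)) \<in> borel_measurable (lebesgue_on {l..u})"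
      by (rule continuous_imp_measurable_on_sets_lebesgue[OF cont]) simp
    show "bounded ((\<lambda>t. \<phi> (t, 0)) ` {l..u})"
      by (intro compact_imp_bounded compact_continuous_image cont) simp
    show "c absolutely_integrable_on {l..u}"
      using assms(3) lu(1) by (simp add: locally_integrable_on_def)
  qed simp
  then have "(\<lambda>t. c t * \<phi> (t, 0)) integrable_on {l..u}"
    by (simp add: mult.commute set_lebesgue_integral_eq_integral(1))
  moreover have "c t * \<phi> (t, 0) = 0" if "t \<notin> {l..u}" for t
    using that lu(2)[of t 0] notin_supp[of "(t, 0)" \<phi>] by fastforce
  ultimately show "(\<lambda>t. c t * \<phi> (t, 0)) integrable_on T"
    using lu(1) by (rule integrable_on_superset)
qed

lemma continuous_imp_locally_integrable: "continuous_on T c \<Longrightarrow> locally_integrable_on c T"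
  unfolding locally_integrable_on_def
  using absolutely_integrable_continuous_real continuous_on_subset by blast

text \<open>The product \<open>c \<phi>\<close> is differentiable everywhere, so the fundamental
  theorem applies to its whole derivative without continuity of \<open>c'\<close>. Subtracting the
  integrable term with the continuous \<open>c\<close> yields integrability of
  \<open>c' \<phi>\<close> as a conclusion.\<close>

lemma integration_by_parts_test_function:
  assumes T: "open T" "is_interval T"
    and c: "\<And>t. t \<in> T \<Longrightarrow> (c has_real_derivative c' t) (at t)"
    and \<phi>: "\<phi> \<in> test_functions (T \<times> X)"
  shows "((\<lambda>t. c' t * \<phi> (t, 0)) has_integral - integral T (\<lambda>t. c t * partial_t \<phi> (t, 0))) T"
proof -
  obtain l u where lu: "{l..u} \<subseteq> T" "\<And>t x. (t, x) \<in> supp \<phi> \<Longrightarrow> l < t \<and> t < u"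
    using compact_subset_time_interval[OF T] \<phi> unfolding test_functions_iff by metis
  have smooth: "smooth \<phi>" using \<phi> by (simp add: test_functions_iff)
  \<comment> \<open>The endpoints \<open>l\<close> and \<open>u\<close> are included here, which
    removes both boundary terms below.\<close>
  have zero: "\<phi> (t, 0) = 0" if "t \<notin> {l<..<u}" for t
    using that lu(2)[of t 0] notin_supp[of "(t, 0)" \<phi>] by fastforce
  have "((\<lambda>t. c' t * \<phi> (t, 0) + c t * partial_t \<phi> (t, 0)) has_integral 0) {l..u}"
  proof (cases "l \<le> u")
    case True
    have "((\<lambda>t. c t * \<phi> (t, 0)) has_real_derivative c' t * \<phi> (t, 0) + c t * partial_t \<phi> (t, 0))
        (at t within {l..u})" if "t \<in> {l..u}" for t
      using DERIV_mult'[OF has_field_derivative_at_within[OF c] slice_t_has_derivative[OF smooth]]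
        that lu(1) by (simp add: add.commute subset_iff)
    then have "((\<lambda>t. c' t * \<phi> (t, 0) + c t * partial_t \<phi> (t, 0)) has_integral
        c u * \<phi> (u, 0) - c l * \<phi> (l, 0)) {l..u}"
      using True by (intro fundamental_theorem_of_calculus)
        (auto simp flip: has_real_derivative_iff_has_vector_derivative)
    then show ?thesis by (simp add: zero)
  qed simp
  moreover have "c' t * \<phi> (t, 0) + c t * partial_t \<phi> (t, 0) = 0" if "t \<notin> {l..u}" for t
  proof -
    have "(t, 0) \<notin> supp \<phi>" using lu(2)[of t 0] that by auto
    moreover from this have "(t, 0) \<notin> supp (partial_t \<phi>)" using supp_partial_t by blast
    ultimately show ?thesis by (simp add: notin_supp)
  qed
  ultimately have sum: "((\<lambda>t. c' t * \<phi> (t, 0) + c t * partial_t \<phi> (t, 0)) has_integral 0) T"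
    using lu(1) by (rule has_integral_on_superset)
  have "continuous_on T c"
    using c by (meson DERIV_isCont continuous_at_imp_continuous_on)
  then have "(\<lambda>t. c t * partial_t \<phi> (t, 0)) integrable_on T"
    using pairs_with_tests_locally_integrable[OF T continuous_imp_locally_integrable]
      test_functions_partial_t[OF \<phi>] by (auto simp: pairs_with_tests_def)
  from has_integral_diff[OF sum integrable_integral[OF this]] show ?thesis by simp
qed

lemma pairs_with_tests_derivative:
  assumes "open T" "is_interval T" "\<And>t. t \<in> T \<Longrightarrow> (c has_real_derivative c' t) (at t)"
  shows "pairs_with_tests T X c'"
  using integration_by_parts_test_function[OF assms] by (auto simp: pairs_with_tests_def)

text \<open>Integration by parts applied to the test function
  \<open>(partial_x ^^ m) \<phi>\<close>, after commuting the time derivative outwards.\<close>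

lemma time_times_delta_partial_t:
  assumes "open T" "is_interval T" "\<And>t. t \<in> T \<Longrightarrow> (c has_real_derivative c' t) (at t)"
    and \<phi>: "\<phi> \<in> test_functions (T \<times> X)"
  shows "time_times T c (delta m) (partial_t \<phi>) = - time_times T c' (delta m) \<phi>"
proof -
  have "(partial_x ^^ m) \<phi> \<in> test_functions (T \<times> X)"
    using test_functions_partials[OF \<phi>, of 0 m] by simp
  from integral_unique[OF integration_by_parts_test_function[OF assms(1-3) this]]
  show ?thesis using \<phi> by (simp add: time_times_delta partial_x_pow_partial_t test_functions_iff)
qed

text \<open>Splitting the integral requires each summand to be integrable against test functions,
  hence the condition on every \<open>c i\<close>.\<close>

lemma time_times_delta_sum:
  assumes "finite I" "\<And>i. i \<in> I \<Longrightarrow> pairs_with_tests T X (c i)" "\<phi> \<in> test_functions (T \<times> X)"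
  shows "time_times T (\<lambda>t. \<Sum>i\<in>I. c i t) (delta m) \<phi> = (\<Sum>i\<in>I. time_times T (c i) (delta m) \<phi>)"
proof -
  have "(\<lambda>t. c i t * (partial_x ^^ m) \<phi> (t, 0)) integrable_on T" if "i \<in> I" for i
    using pairs_with_testsD[OF assms(2)[OF that] assms(3)] .
  then show ?thesis
    using assms(1) by (simp add: time_times_delta sum_distrib_right integral_sum sum_distrib_left)
qed

text \<open>On the compact time interval around \<open>K\<close> the continuous \<open>c\<close> is
  bounded by some \<open>B\<close>, so the estimate holds with order \<open>m\<close> and constant
  \<open>B\<close> times the interval length.\<close>

lemma distribution_time_times_delta:
  assumes T: "open T" "is_interval T" and c: "continuous_on T c"
  shows "distribution (T \<times> X) (time_times T c (delta m))"
  unfolding distribution_iff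
proof (intro conjI allI impI ballI)
  have int: "(\<lambda>t. c t * (partial_x ^^ m) \<phi> (t, 0)) integrable_on T"
    if "\<phi> \<in> test_functions (T \<times> X)" for \<phi>
    using pairs_with_testsD[OF pairs_with_tests_locally_integrable[OF T
      continuous_imp_locally_integrable[OF c]] that] .
  {
    fix \<phi> \<eta> assume "\<phi> \<in> test_functions (T \<times> X)" "\<eta> \<in> test_functions (T \<times> X)"
    then show "time_times T c (delta m) (\<lambda>p. \<phi> p + \<eta> p) =
        time_times T c (delta m) \<phi> + time_times T c (delta m) \<eta>"
      by (simp add: time_times_delta partial_x_pow_add test_functions_iff distrib_left
          integral_add int[unfolded test_functions_iff])
  next
    fix \<phi> d assume "\<phi> \<in> test_functions (T \<times> X)"
    then show "time_times T c (delta m) (\<lambda>p. d * \<phi> p) = d * time_times T c (delta m) \<phi>"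
      by (simp add: time_times_delta partial_x_pow_cmult test_functions_iff mult.left_commute[of _ d])
  next
    fix K assume K: "compact K \<and> K \<subseteq> T \<times> X"
    obtain l u where lu: "{l..u} \<subseteq> T" "\<And>t x. (t, x) \<in> K \<Longrightarrow> l < t \<and> t < u"
      using compact_subset_time_interval[OF T] K by metis
    have "bounded (c ` {l..u})"
      using c lu(1) by (meson compact_Icc compact_continuous_image compact_imp_bounded continuous_on_subset)
    then obtain B where B: "0 \<le> B" "\<And>t. t \<in> {l..u} \<Longrightarrow> \<bar>c t\<bar> \<le> B"
      unfolding bounded_pos by (auto dest: less_imp_le)
    have "\<bar>time_times T c (delta m) \<phi>\<bar> \<le> (B * measure lborel {l..u}) * seminorm m \<phi>"
      if \<phi>: "\<phi> \<in> test_functions (T \<times> X)" "supp \<phi> \<subseteq> K" for \<phi>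
    proof -
      let ?f = "\<lambda>t. c t * (partial_x ^^ m) \<phi> (t, 0)"
      have "(t, 0) \<notin> supp ((partial_x ^^ m) \<phi>)" if "t \<notin> {l..u}" for t
        using lu(2)[of t 0] that \<phi>(2) supp_partial_x_pow[of m \<phi>] by auto
      then have zero: "?f t = 0" if "t \<notin> {l..u}" for t
        using that by (simp add: notin_supp)
      have "?f integrable_on {l..u}"
        using integrable_on_subinterval[OF int[OF \<phi>(1)] lu(1)] .
      moreover have "norm (?f t) \<le> B * seminorm m \<phi>" if "t \<in> cbox l u" for t
        using B that abs_partial_x_pow_le_seminorm[OF \<phi>(1)]
        by (auto simp: abs_mult intro!: mult_mono)
      ultimately have "norm (integral {l..u} ?f) \<le> B * seminorm m \<phi> * measure lborel (cbox l u)"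
        using has_integral_bound[of "B * seminorm m \<phi>" ?f _ l u] B(1) seminorm_nonneg[OF \<phi>(1)]
        by (simp add: integrable_integral)
      moreover have "integral T ?f = integral {l..u} ?f"
        using has_integral_on_superset[OF integrable_integral[OF \<open>?f integrable_on {l..u}\<close>] zero lu(1)]
        by (rule integral_unique)
      ultimately show ?thesis
        by (simp add: time_times_delta abs_mult power_abs mult_ac)
    qed
    then show "\<exists>C k. \<forall>\<phi>\<in>test_functions (T \<times> X). supp \<phi> \<subseteq> K \<longrightarrow>
        \<bar>time_times T c (delta m) \<phi>\<bar> \<le> C * seminorm k \<phi>"
      by blast
  }
qed

subsection \<open>The regularised wave equation\<close>

lemma times_differentiable_on_has_derivative:
  assumes "times_differentiable_on n f T" "open T" "k < n" "t \<in> T"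
  shows "((deriv ^^ k) f has_real_derivative (deriv ^^ Suc k) f t) (at t)"
proof -
  have "(deriv ^^ k) f differentiable (at t)"
    using assms at_within_open[of t T] by (metis times_differentiable_on_def differentiable_on_def)
  then show ?thesis by (simp add: DERIV_deriv_iff_real_differentiable)
qed

lemma wave_eq: "wave u \<phi> = u (partial_x (partial_x \<phi>)) - u (partial_t (partial_t \<phi>))"
  by (simp add: wave_def dist_t_def dist_x_def)

section \<open>Rearrangement of the finite sums and the main computation\<close>

lemma sum_atMost_even_odd:
  "(\<Sum>n\<le>2 * M + 1. g n) = (\<Sum>n\<le>M. g (2 * n)) + (\<Sum>n\<le>M. g (2 * n + 1))"
  for g :: "nat \<Rightarrow> 'a::comm_monoid_add"
  by (induction M) (simp_all add: ac_simps)

text \<open>The differences telescope along each antidiagonal \<open>i + n\<close>, from its end at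
  \<open>n = 0\<close> to its end at \<open>i = 0\<close>. In the application one antidiagonal
  carries the successive reductions of a single source coefficient.\<close>

lemma triangular_sum_telescope:
  fixes H :: "nat \<Rightarrow> nat \<Rightarrow> 'a::ab_group_add"
  shows "(\<Sum>i\<le>M. H i 0) - (\<Sum>i<M. \<Sum>n<M - i. H (i + 1) n - H i (n + 1)) = (\<Sum>n\<le>M. H 0 n)"
proof (induction M)
  case (Suc M)
  let ?D = "\<lambda>i n. H (i + 1) n - H i (n + 1)"
  have "(\<Sum>i<Suc M. \<Sum>n<Suc M - i. ?D i n) = (\<Sum>i<Suc M. (\<Sum>n<M - i. ?D i n) + ?D i (M - i))"
    by (intro sum.cong) (simp_all add: Suc_diff_le)
  \<comment> \<open>The index \<open>i = M\<close> contributes an empty inner sum, so only the new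
    antidiagonal runs up to \<open>M\<close>.\<close>
  also have "\<dots> = (\<Sum>i<M. \<Sum>n<M - i. ?D i n) + (\<Sum>i<Suc M. ?D i (M - i))"
    by (simp add: sum.distrib ac_simps)
  \<comment> \<open>Both arguments now have the form \<open>H i (Suc M - i)\<close> at consecutive
    \<open>i\<close>, which makes the sum telescope.\<close>
  also have "(\<Sum>i<Suc M. ?D i (M - i)) = (\<Sum>i<Suc M. H (Suc i) (Suc M - Suc i) - H i (Suc M - i))"
    by (intro sum.cong) (simp_all add: Suc_diff_le)
  also have "\<dots> = H (Suc M) 0 - H 0 (Suc M)"
    by (subst sum_lessThan_telescope) simp
  finally show ?case
    using Suc by (simp add: algebra_simps)
qed simp

text \<open>The case of odd order, with \<open>M\<close> in the role of \<open>(N - 1) / 2\<close>;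
  even order reduces to it by padding.\<close>

lemma psi_bar_odd_order:
  fixes T X :: "real set" and b :: "nat \<Rightarrow> real \<Rightarrow> real"
  assumes T: "open T" "is_interval T"
    and loc: "\<And>n. n \<le> 2 * M + 1 \<Longrightarrow> locally_integrable_on (b n) T"
    and diff: "\<And>n. n \<le> 2 * M + 1 \<Longrightarrow> times_differentiable_on n (b n) T"
    and \<psi>: "distribution (T \<times> X) \<psi>"
    and wave: "\<And>\<phi>. \<phi> \<in> test_functions (T \<times> X) \<Longrightarrow>
      wave \<psi> \<phi> = (\<Sum>n\<le>2 * M + 1. time_times T (b n) (delta n) \<phi>)"
  shows "distribution (T \<times> X) (psi_bar T (2 * M + 1) b \<psi>)" (is ?distribution)
    and "\<phi> \<in> test_functions (T \<times> X) \<Longrightarrow> wave (psi_bar T (2 * M + 1) b \<psi>) \<phi> =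
      time_times T (G_coeff (2 * M + 1) b) (delta 0) \<phi> +
      time_times T (F_coeff (2 * M + 1) b) (delta 1) \<phi>" (is "_ \<Longrightarrow> ?wave")
proof -
  have deriv: "((deriv ^^ k) (b j) has_real_derivative (deriv ^^ Suc k) (b j) t) (at t)"
    if "k < j" "j \<le> 2 * M + 1" "t \<in> T" for j k t
    using times_differentiable_on_has_derivative[OF diff T(1)] that by blast
  have cont: "continuous_on T ((deriv ^^ k) (b j))" if "k < j" "j \<le> 2 * M + 1" for j k
    using deriv[OF that] by (meson DERIV_isCont continuous_at_imp_continuous_on)
  \<comment> \<open>The top order \<open>k = j\<close> is included, as \<open>G_coeff\<close>
    contains it. Order 0 rests on local integrability; a positive order is the derivative of an
    everywhere differentiable function.\<close>
  have pairs: "pairs_with_tests T X ((deriv ^^ k) (b j))" if "k \<le> j" "j \<le> 2 * M + 1" for j k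
  proof (cases k)
    case 0
    then show ?thesis using pairs_with_tests_locally_integrable[OF T loc[OF that(2)]] by simp
  next
    case (Suc l)
    then show ?thesis using pairs_with_tests_derivative[OF T deriv[of l j]] that by simp
  qed

  \<comment> \<open>Every coefficient in \<open>psi_bar\<close> is differentiated at least two times
    fewer than its index, hence continuous.\<close>
  show ?distribution
    unfolding psi_bar_def
    by (intro distribution_diff[OF \<psi>] distribution_sum distribution_add
        distribution_time_times_delta[OF T] continuous_on_sum cont) auto

  assume \<phi>: "\<phi> \<in> test_functions (T \<times> X)"
  define E where "E k j m \<phi> = time_times T ((deriv ^^ k) (b j)) (delta m) \<phi>" for k j m \<phi>
  have E_xx: "E k j m (partial_x (partial_x \<phi>)) = E k j (m + 2) \<phi>" for k j m
    unfolding E_def by (rule time_times_delta_partial_x)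
  \<comment> \<open>Two integrations by parts, whose signs cancel. The extreme case
    \<open>k + 2 = j\<close> occurs in \<open>S_tt\<close> at \<open>i = 0\<close>.\<close>
  have E_tt: "E k j m (partial_t (partial_t \<phi>)) = E (k + 2) j m \<phi>"
    if "k + 2 \<le> j" "j \<le> 2 * M + 1" for k j m
  proof -
    have "E k j m (partial_t (partial_t \<phi>)) = - E (Suc k) j m (partial_t \<phi>)"
      unfolding E_def using that
      by (intro time_times_delta_partial_t[OF T deriv test_functions_partial_t[OF \<phi>]]) auto
    also have "E (Suc k) j m (partial_t \<phi>) = - E (Suc (Suc k)) j m \<phi>"
      unfolding E_def using that by (intro time_times_delta_partial_t[OF T deriv \<phi>]) auto
    finally show ?thesis by simp
  qed
  have sum_E: "time_times T (\<lambda>t. \<Sum>n\<in>I. (deriv ^^ k n) (b (j n)) t) (delta m) \<eta> = (\<Sum>n\<in>I. E (k n) (j n) m \<eta>)"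
    if "\<eta> \<in> test_functions (T \<times> X)" "finite I" "\<And>n. n \<in> I \<Longrightarrow> k n \<le> j n \<and> j n \<le> 2 * M + 1"
    for I k j m \<eta>
    unfolding E_def using that by (intro time_times_delta_sum[OF _ pairs]) auto

  define S where "S \<eta> = (\<Sum>i<M. (\<Sum>n<M - i. E (2 * n) (2 * n + 2 * i + 2) (2 * i) \<eta>) +
      (\<Sum>n<M - i. E (2 * n) (2 * n + 2 * i + 3) (2 * i + 1) \<eta>))" for \<eta>
  have psi_bar_eq: "psi_bar T (2 * M + 1) b \<psi> \<eta> = \<psi> \<eta> - S \<eta>" if "\<eta> \<in> test_functions (T \<times> X)" for \<eta>
  proof -
    have "time_times T (\<lambda>t. \<Sum>n<M - i. (deriv ^^ (2 * n)) (b (2 * n + 2 * i + 2)) t) (delta (2 * i)) \<eta> =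
        (\<Sum>n<M - i. E (2 * n) (2 * n + 2 * i + 2) (2 * i) \<eta>)"
      "time_times T (\<lambda>t. \<Sum>n<M - i. (deriv ^^ (2 * n)) (b (2 * n + 2 * i + 3)) t) (delta (2 * i + 1)) \<eta> =
        (\<Sum>n<M - i. E (2 * n) (2 * n + 2 * i + 3) (2 * i + 1) \<eta>)" for i
      by (rule sum_E[OF that]; auto)+
    then show ?thesis by (simp add: psi_bar_def S_def)
  qed
  have S_xx: "S (partial_x (partial_x \<phi>)) =
      (\<Sum>i<M. (\<Sum>n<M - i. E (2 * n) (2 * n + 2 * i + 2) (2 * i + 2) \<phi>) +
        (\<Sum>n<M - i. E (2 * n) (2 * n + 2 * i + 3) (2 * i + 3) \<phi>))"
    unfolding S_def E_xx by (simp add: numeral_3_eq_3)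
  have S_tt: "S (partial_t (partial_t \<phi>)) =
      (\<Sum>i<M. (\<Sum>n<M - i. E (2 * n + 2) (2 * n + 2 * i + 2) (2 * i) \<phi>) +
        (\<Sum>n<M - i. E (2 * n + 2) (2 * n + 2 * i + 3) (2 * i + 1) \<phi>))"
    unfolding S_def by (intro sum.cong refl arg_cong2[where f = "(+)"] E_tt) auto
  \<comment> \<open>Here \<open>p\<close> is the parity of the delta order. The space half of the
    wave operator turns a correction term into \<open>?H p (i + 1) n\<close>, the time half into
    \<open>?H p i (n + 1)\<close>. The source is the edge \<open>n = 0\<close>, and the edge
    \<open>i = 0\<close> gives \<open>G\<close> and \<open>F\<close>.\<close>
  let ?H = "\<lambda>p i n. E (2 * n) (2 * n + 2 * i + p) (2 * i + p) \<phi>"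
  have "wave (psi_bar T (2 * M + 1) b \<psi>) \<phi> = wave \<psi> \<phi> - (S (partial_x (partial_x \<phi>)) - S (partial_t (partial_t \<phi>)))"
    unfolding wave_eq psi_bar_eq[OF test_functions_partial_x[OF test_functions_partial_x[OF \<phi>]]]
      psi_bar_eq[OF test_functions_partial_t[OF test_functions_partial_t[OF \<phi>]]]
    by simp
  also have "S (partial_x (partial_x \<phi>)) - S (partial_t (partial_t \<phi>)) =
      (\<Sum>i<M. \<Sum>n<M - i. ?H 0 (i + 1) n - ?H 0 i (n + 1)) +
      (\<Sum>i<M. \<Sum>n<M - i. ?H 1 (i + 1) n - ?H 1 i (n + 1))"
    unfolding S_xx S_tt
    by (simp add: sum.distrib sum_subtractf algebra_simps numeral_3_eq_3)
  also have "wave \<psi> \<phi> = (\<Sum>i\<le>M. ?H 0 i 0) + (\<Sum>i\<le>M. ?H 1 i 0)"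
    unfolding wave[OF \<phi>] sum_atMost_even_odd by (simp add: E_def)
  also have "(\<Sum>i\<le>M. ?H 0 i 0) + (\<Sum>i\<le>M. ?H 1 i 0) -
      ((\<Sum>i<M. \<Sum>n<M - i. ?H 0 (i + 1) n - ?H 0 i (n + 1)) +
       (\<Sum>i<M. \<Sum>n<M - i. ?H 1 (i + 1) n - ?H 1 i (n + 1))) =
      (\<Sum>n\<le>M. ?H 0 0 n) + (\<Sum>n\<le>M. ?H 1 0 n)"
    using triangular_sum_telescope[of "?H 0" M] triangular_sum_telescope[of "?H 1" M]
    by linarith
  also have "(\<Sum>n\<le>M. ?H 0 0 n) = time_times T (G_coeff (2 * M + 1) b) (delta 0) \<phi>"
  proof -
    have "G_coeff (2 * M + 1) b = (\<lambda>t. \<Sum>n\<le>M. (deriv ^^ (2 * n)) (b (2 * n)) t)"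
      by (rule ext) (simp add: G_coeff_def)
    then show ?thesis using sum_E[OF \<phi>, of "{..M}" "\<lambda>n. 2 * n" "\<lambda>n. 2 * n" 0] by simp
  qed
  also have "(\<Sum>n\<le>M. ?H 1 0 n) = time_times T (F_coeff (2 * M + 1) b) (delta 1) \<phi>"
  proof -
    have "F_coeff (2 * M + 1) b = (\<lambda>t. \<Sum>n\<le>M. (deriv ^^ (2 * n)) (b (2 * n + 1)) t)"
      by (rule ext) (simp add: F_coeff_def)
    then show ?thesis using sum_E[OF \<phi>, of "{..M}" "\<lambda>n. 2 * n" "\<lambda>n. 2 * n + 1" 1] by simp
  qed
  finally show ?wave .
qed

lemma deriv_pow_zero: "(deriv ^^ k) (\<lambda>t. 0) = (\<lambda>t. 0 :: real)"
  by (induction k) simp_all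

theorem theorem1:
  fixes N :: nat and a :: "nat \<Rightarrow> real \<Rightarrow> real" and T :: "real set" and x\<^sub>1 x\<^sub>2 :: real
    and \<psi> :: "(real \<times> real \<Rightarrow> real) \<Rightarrow> real"
  assumes "open T" and "is_interval T"
    and "\<And>n. n \<le> N \<Longrightarrow> locally_integrable_on (a n) T"
    and "\<And>n. n \<le> N \<Longrightarrow> times_differentiable_on n (a n) T"
    and "distribution (T \<times> {x\<^sub>1<..<x\<^sub>2}) \<psi>"
    and "\<And>\<phi>. \<phi> \<in> test_functions (T \<times> {x\<^sub>1<..<x\<^sub>2}) \<Longrightarrow>
           wave \<psi> \<phi> = (\<Sum>n\<le>N. time_times T (a n) (delta n) \<phi>)"
  shows "distribution (T \<times> {x\<^sub>1<..<x\<^sub>2}) (psi_bar T (odd_order N) (padded N a) \<psi>) \<and>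
         (\<forall>\<phi>\<in>test_functions (T \<times> {x\<^sub>1<..<x\<^sub>2}).
            wave (psi_bar T (odd_order N) (padded N a) \<psi>) \<phi> =
              time_times T (G_coeff (odd_order N) (padded N a)) (delta 0) \<phi> +
              time_times T (F_coeff (odd_order N) (padded N a)) (delta 1) \<phi>)"
proof -
  \<comment> \<open>Covers both parities: \<open>N\<close> is \<open>2 * M + 1\<close> or
    \<open>2 * M\<close>, and the odd order is \<open>2 * M + 1\<close> in each case.\<close>
  define M where "M = N div 2"
  have odd_order: "odd_order N = 2 * M + 1"
    by (auto simp: odd_order_def M_def elim: oddE)
  have N_le: "N \<le> 2 * M + 1" by (simp add: M_def)
  have "locally_integrable_on (padded N a n) T" "times_differentiable_on n (padded N a n) T" for n
    using assms(3,4)[of n]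
    by (auto simp: padded_def locally_integrable_on_def times_differentiable_on_def deriv_pow_zero)
  moreover have "wave \<psi> \<phi> = (\<Sum>n\<le>2 * M + 1. time_times T (padded N a n) (delta n) \<phi>)"
    if "\<phi> \<in> test_functions (T \<times> {x\<^sub>1<..<x\<^sub>2})" for \<phi>
  proof -
    have "(\<Sum>n\<le>2 * M + 1. time_times T (padded N a n) (delta n) \<phi>) =
        (\<Sum>n\<le>N. time_times T (padded N a n) (delta n) \<phi>)"
      \<comment> \<open>The only possible extra index is \<open>N + 1\<close>, for even
        \<open>N\<close>, where the padded coefficient is zero.\<close>
      using N_le by (intro sum.mono_neutral_right) (auto simp: padded_def time_times_def)
    then show ?thesis by (simp add: assms(6)[OF that] padded_def)
  qed
  ultimately show ?thesis
    unfolding odd_order using psi_bar_odd_order[OF assms(1,2) _ _ assms(5)] by blast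
qed

end
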